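(* Let $\mu$ be a positive Borel measure on $\mathbb{R}$ with finite moments of all orders, let $(f,g)_0=\int_{\mathbb{R}} f(t)g(t)\,d\mu(t)$ for $f,g\in\mathcal{P}$, and let $[\cdot,\cdot]_2$ be a double Geronimus transformation of $(\cdot,\cdot)_0$. Assume that $(\cdot,\cdot)_0$ and $[\cdot,\cdot]_2$ are positive definite, and let $\{P_n\}_{n=0}^\infty$ and $\{P_n^{**}\}_{n=0}^\infty$ be the corresponding sequences of monic orthogonal polynomials. Let $h_n$, $h_n^{**}$, $B_n$, $C_n$ and the matrix $J^{**}$ be as defined in the context. Then $J^{**}$ admits the Cholesky decomposition $$J^{**}=LL^{\top},$$ where the lower triangular matrix $L$ has only three nonvanishing diagonals and is of the form $$L=\begin{pmatrix} \frac{h_0}{h_0^{**}}& 0& & &\\ B_1\frac{h_0}{h_1^{**}} & \frac{h_1}{h_1^{**}} & 0 & &\\ C_2\frac{h_0}{h_2^{**}} & B_2\frac{h_1}{h_2^{**}} & \frac{h_2}{h_2^{**}} & 0 &\\ 0 & C_3\frac{h_1}{h_3^{**}} & B_3\frac{h_2}{h_3^{**}} & \frac{h_3}{h_3^{**}} & \ddots\\ & & \ddots & \ddots & \ddots \end{pmatrix},$$ i.e. $L_{n,n}=h_n/h_n^{**}$, $L_{n,n-1}=B_nh_{n-1}/h_n^{**}$ for $n\ge1$, $L_{n,n-2}=C_nh_{n-2}/h_n^{**}$ for $n\ge 2$, and all other entries are zero. Moreover, the ratio $h_{n+2}/h_{n+2}^{**}$ is given by $$\frac{h_{n+2}}{h_{n+2}^{**}}=\frac{h_{n+2}}{\sqrt{C_{n+2}}\,h_n},\qquad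 n=0,1,\dots.$$
   Context: $\mathcal{P}$ is the linear space of polynomials in one variable $t$ with real coefficients. A symmetric bilinear form on $\mathcal{P}$ is positive definite if all leading principal submatrices of its Gram matrix with respect to the monomials $1,t,t^2,\dots$ are positive definite. A double Geronimus transformation of $(\cdot,\cdot)_0$ is any symmetric bilinear form $[\cdot,\cdot]_2:\mathcal{P}\times\mathcal{P}\to\mathbb{R}$ such that $$[t^2f(t),g(t)]_2=[f(t),t^2g(t)]_2=(f,g)_0,\qquad f,g\in\mathcal{P}.$$ Notation: $h_n>0$ with $h_n^2=(P_n,P_n)_0$; $h_n^{**}>0$ with $(h_n^{**})^2=[P_n^{**},P_n^{**}]_2$; $\widehat{P}_n^{**}=P_n^{**}/h_n^{**}$ are the orthonormal polynomials for $[\cdot,\cdot]_2$. The infinite symmetric matrix $J^{**}$ is $$J^{**}=\left([t^2\widehat{P}_n^{**}(t),\widehat{P}_m^{**}(t)]_2\right)_{n,m=0}^{\infty}.$$ The real numbers $B_n$ ($n\ge1$) and $C_n$ ($n\ge2$) are the coefficients in the expansion $$P_n^{**}(t)=P_n(t)+B_nP_{n-1}(t)+C_nP_{n-2}(t),$$ with $P_1^{**}=P_1+B_1P_0$ and $P_0^{**}=P_0=1$; such an expansion always exists. Matrix rows and columns are indexed from $0$. *)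

theory Defs
  imports "HOL-Analysis.Analysis" "HOL-Computational_Algebra.Polynomial"
begin

type_synonym poly_form = "real poly \<Rightarrow> real poly \<Rightarrow> real"

text \<open>Infinite matrices, with rows and columns indexed from 0.\<close>

type_synonym inf_matrix = "nat \<Rightarrow> nat \<Rightarrow> real"

definition symmetric_bilinear_form :: "poly_form \<Rightarrow> bool" where
  "symmetric_bilinear_form \<phi> \<longleftrightarrow>
     (\<forall>f g. \<phi> f g = \<phi> g f) \<and>
     (\<forall>f. Vector_Spaces.linear smult (*) (\<lambda>g. \<phi> f g)) \<and>
     (\<forall>g. Vector_Spaces.linear smult (*) (\<lambda>f. \<phi> f g))"

definition gram_matrix :: "poly_form \<Rightarrow> inf_matrix" where
  "gram_matrix \<phi> i j = \<phi> (monom 1 i) (monom 1 j)"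

text \<open>The leading principal submatrix of size \<open>n\<close> is positive definite;
  only the entries of \<open>x\<close> below \<open>n\<close> matter.\<close>

definition leading_submatrix_pos_def :: "inf_matrix \<Rightarrow> nat \<Rightarrow> bool" where
  "leading_submatrix_pos_def A n \<longleftrightarrow>
     (\<forall>x :: nat \<Rightarrow> real. (\<exists>i<n. x i \<noteq> 0) \<longrightarrow> (\<Sum>i<n. \<Sum>j<n. x i * A i j * x j) > 0)"

definition positive_definite_form :: "poly_form \<Rightarrow> bool" where
  "positive_definite_form \<phi> \<longleftrightarrow> (\<forall>n. leading_submatrix_pos_def (gram_matrix \<phi>) n)"

definition borel_measure_with_moments :: "real measure \<Rightarrow> bool" where
  "borel_measure_with_moments \<mu> \<longleftrightarrow>
     sets \<mu> = sets borel \<and> (\<forall>n::nat. integrable \<mu> (\<lambda>t. t ^ n))"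

definition measure_form :: "real measure \<Rightarrow> poly_form" where
  "measure_form \<mu> f g = (LINT t|\<mu>. poly f t * poly g t)"

definition double_geronimus :: "poly_form \<Rightarrow> poly_form \<Rightarrow> bool" where
  "double_geronimus \<phi> \<psi> \<longleftrightarrow> symmetric_bilinear_form \<psi> \<and>
     (\<forall>f g. \<psi> (monom 1 2 * f) g = \<phi> f g \<and> \<psi> f (monom 1 2 * g) = \<phi> f g)"

definition monic_orthogonal_polys :: "poly_form \<Rightarrow> (nat \<Rightarrow> real poly) \<Rightarrow> bool" where
  "monic_orthogonal_polys \<phi> P \<longleftrightarrow>
     (\<forall>n. degree (P n) = n \<and> lead_coeff (P n) = 1) \<and>
     (\<forall>m n. m \<noteq> n \<longrightarrow> \<phi> (P m) (P n) = 0)"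

text \<open>\<open>B 0\<close>, \<open>C 0\<close> and \<open>C 1\<close> are unconstrained and carry no meaning.\<close>

definition connection_coeffs ::
  "(nat \<Rightarrow> real poly) \<Rightarrow> (nat \<Rightarrow> real poly) \<Rightarrow> (nat \<Rightarrow> real) \<Rightarrow> (nat \<Rightarrow> real) \<Rightarrow> bool" where
  "connection_coeffs P Q B C \<longleftrightarrow>
     Q 0 = P 0 \<and>
     Q 1 = P 1 + smult (B 1) (P 0) \<and>
     (\<forall>n\<ge>2. Q n = P n + smult (B n) (P (n - 1)) + smult (C n) (P (n - 2)))"

text \<open>The matrix of multiplication by \<open>t\<^sup>2\<close> with respect to the normalized polynomials
  \<open>Q n / k n\<close>.\<close>

definition J_matrix :: "poly_form \<Rightarrow> (nat \<Rightarrow> real poly) \<Rightarrow> (nat \<Rightarrow> real) \<Rightarrow> inf_matrix" where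
  "J_matrix \<psi> Q k n m = \<psi> (monom 1 2 * smult (1 / k n) (Q n)) (smult (1 / k m) (Q m))"

text \<open>The series defining a product is a finite sum whenever the rows of the left factor are
  finitely supported, in particular when that factor is lower triangular.\<close>

definition inf_matrix_mult :: "inf_matrix \<Rightarrow> inf_matrix \<Rightarrow> inf_matrix" where
  "inf_matrix_mult A B = (\<lambda>i j. \<Sum>k. A i k * B k j)"

definition inf_transpose :: "inf_matrix \<Rightarrow> inf_matrix" where
  "inf_transpose A = (\<lambda>i j. A j i)"

definition cholesky_decomposition :: "inf_matrix \<Rightarrow> inf_matrix \<Rightarrow> bool" where
  "cholesky_decomposition A L \<longleftrightarrow>
     (\<forall>i j. i < j \<longrightarrow> L i j = 0) \<and> (\<forall>i. L i i > 0) \<and>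
     A = inf_matrix_mult L (inf_transpose L)"

definition L_matrix ::
  "(nat \<Rightarrow> real) \<Rightarrow> (nat \<Rightarrow> real) \<Rightarrow> (nat \<Rightarrow> real) \<Rightarrow> (nat \<Rightarrow> real) \<Rightarrow> inf_matrix" where
  "L_matrix h k B C n m =
     (if m = n then h n / k n
      else if n \<ge> 1 \<and> m = n - 1 then B n * h (n - 1) / k n
      else if n \<ge> 2 \<and> m = n - 2 then C n * h (n - 2) / k n
      else 0)"

end

theory Submission
  imports Defs
begin

text \<open>
  Write \<open>\<phi>\<close> for the form of the measure, \<open>\<psi>\<close> for its double Geronimus transformation, and \<open>P\<close>
  and \<open>Q\<close> for their respective monic orthogonal polynomials.
  Multiplication by \<open>t\<^sup>2\<close> turns \<open>\<psi>\<close> back into \<open>\<phi>\<close>, so the matrix of this multiplication in the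
  \<open>\<psi>\<close>-orthonormal polynomials is nothing but their Gram matrix with respect to \<open>\<phi>\<close>. The
  connection coefficients, rescaled by the norms, are the coordinates of these polynomials in the
  \<open>\<phi>\<close>-orthonormal basis \<open>P k / h k\<close> (lemma \<open>connection_expansion\<close>); they form the rows of \<open>L\<close>.
  A Gram matrix is the product of the coordinate matrix with its transpose, whence \<open>J = L L\<^sup>T\<close>
  (lemma \<open>J_matrix_entry\<close>).

  The formula for the ratio of the norms comes from computing \<open>\<phi> (Q (n + 2)) (P n)\<close> twice
  (lemma \<open>second_connection_coeff\<close>). The expansion in the \<open>P k\<close> gives \<open>C (n + 2) (h n)\<^sup>2\<close>. Moving
  \<open>t\<^sup>2\<close> into \<open>\<psi>\<close> gives \<open>\<psi> (Q (n + 2)) (t\<^sup>2 P n)\<close>, and since \<open>t\<^sup>2 P n\<close> is monic of degree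
  \<open>n + 2\<close>, this is the squared norm of \<open>Q (n + 2)\<close>. In particular \<open>C (n + 2)\<close> is positive.

  The symmetry and bilinearity of \<open>\<phi>\<close> used in these computations are inherited from those of
  \<open>\<psi>\<close> (lemma \<open>double_geronimus_imp_symmetric_bilinear\<close>).
\<close>

section \<open>Symmetric bilinear forms on polynomials\<close>

lemma form_sym: "symmetric_bilinear_form \<phi> \<Longrightarrow> \<phi> f g = \<phi> g f"
  by (auto simp: symmetric_bilinear_form_def)

lemma form_add_right: "symmetric_bilinear_form \<phi> \<Longrightarrow> \<phi> f (g + g') = \<phi> f g + \<phi> f g'"
  by (auto simp: symmetric_bilinear_form_def Vector_Spaces.linear_iff)

lemma form_smult_right: "symmetric_bilinear_form \<phi> \<Longrightarrow> \<phi> f (smult c g) = c * \<phi> f g"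
  by (auto simp: symmetric_bilinear_form_def Vector_Spaces.linear_iff)

lemma form_smult_left: "symmetric_bilinear_form \<phi> \<Longrightarrow> \<phi> (smult c f) g = c * \<phi> f g"
  by (metis form_sym form_smult_right)

lemma form_zero_right: "symmetric_bilinear_form \<phi> \<Longrightarrow> \<phi> f 0 = 0"
  using form_smult_right[of \<phi> f 0 0] by simp

lemma form_sum_right:
  assumes "symmetric_bilinear_form \<phi>" and "finite S"
  shows "\<phi> f (\<Sum>k\<in>S. g k) = (\<Sum>k\<in>S. \<phi> f (g k))"
  using assms(2)
  by induction (simp_all add: assms(1) form_add_right form_zero_right)

text \<open>Both partial maps of \<open>\<phi>\<close> are partial maps of \<open>\<psi>\<close>, depending on which side \<open>t\<^sup>2\<close> is put.
  Symmetry follows from having both sides at once.\<close>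

lemma double_geronimus_imp_symmetric_bilinear:
  assumes "double_geronimus \<phi> \<psi>"
  shows "symmetric_bilinear_form \<phi>"
proof -
  have bil: "symmetric_bilinear_form \<psi>"
    and left: "\<And>f g. \<phi> f g = \<psi> (monom 1 2 * f) g"
    and right: "\<And>f g. \<phi> f g = \<psi> f (monom 1 2 * g)"
    using assms by (auto simp: double_geronimus_def)
  have "\<phi> f g = \<phi> g f" for f g
    using form_sym[OF bil, of "monom 1 2 * f" g] by (simp only: left[of f g] right[of g f])
  moreover have "Vector_Spaces.linear smult (*) (\<lambda>g. \<phi> f g)" for f
    using bil unfolding left by (simp add: symmetric_bilinear_form_def)
  moreover have "Vector_Spaces.linear smult (*) (\<lambda>f. \<phi> f g)" for g
    using bil unfolding right by (simp add: symmetric_bilinear_form_def)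
  ultimately show ?thesis
    by (simp add: symmetric_bilinear_form_def)
qed

lemma monic_orthogonal_degree: "monic_orthogonal_polys \<phi> P \<Longrightarrow> degree (P n) = n"
  by (simp add: monic_orthogonal_polys_def)

lemma monic_orthogonal_coeff: "monic_orthogonal_polys \<phi> P \<Longrightarrow> coeff (P n) n = 1"
  unfolding monic_orthogonal_polys_def by (drule conjunct1, drule spec[of _ n]) auto

section \<open>Orthogonality to polynomials of lower degree\<close>

text \<open>Subtracting from \<open>f\<close> a multiple of the monic polynomial \<open>Q d\<close> removes the coefficient of
  \<open>t\<^sup>d\<close> without changing the value of the form. Bounding the degree by vanishing coefficients lets
  the induction start at the zero polynomial.\<close>

lemma monic_orthogonal_lower_degree:
  assumes bil: "symmetric_bilinear_form \<psi>" and orth: "monic_orthogonal_polys \<psi> Q"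
    and "d \<le> n" and "\<And>i. d \<le> i \<Longrightarrow> coeff f i = 0"
  shows "\<psi> (Q n) f = 0"
  using assms(3,4)
proof (induction d arbitrary: f)
  case 0
  then have "f = 0"
    by (intro poly_eqI) simp
  then show ?case
    by (simp add: form_zero_right[OF bil])
next
  case (Suc d)
  have Q: "coeff (Q d) d = 1" "degree (Q d) = d"
    using monic_orthogonal_coeff[OF orth] monic_orthogonal_degree[OF orth] by auto
  define g where "g = f - smult (coeff f d) (Q d)"
  have "coeff g i = 0" if "d \<le> i" for i
    using that Q Suc.prems(2)[of i] coeff_eq_0[of "Q d" i]
    by (cases "i = d") (simp_all add: g_def)
  then have "\<psi> (Q n) g = 0"
    using Suc.IH Suc.prems(1) by simp
  moreover have "\<psi> (Q n) (Q d) = 0"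
    using orth Suc.prems(1) by (simp add: monic_orthogonal_polys_def)
  moreover have "f = g + smult (coeff f d) (Q d)"
    by (simp add: g_def)
  ultimately show ?case
    by (metis form_add_right[OF bil] form_smult_right[OF bil] mult_zero_right add_0)
qed

text \<open>Two monic polynomials of the same degree differ by one of lower degree, which \<open>Q n\<close> does
  not see.\<close>

lemma monic_orthogonal_same_degree:
  assumes bil: "symmetric_bilinear_form \<psi>" and orth: "monic_orthogonal_polys \<psi> Q"
    and "degree f = n" and "lead_coeff f = 1"
  shows "\<psi> (Q n) f = \<psi> (Q n) (Q n)"
proof -
  have Q: "coeff (Q n) n = 1" "degree (Q n) = n"
    using monic_orthogonal_coeff[OF orth] monic_orthogonal_degree[OF orth] by auto
  define g where "g = f - Q n"
  have "coeff g i = 0" if "n \<le> i" for i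
    using that Q assms(3,4) coeff_eq_0[of "Q n" i] coeff_eq_0[of f i]
    by (cases "i = n") (auto simp: g_def)
  then have "\<psi> (Q n) g = 0"
    using monic_orthogonal_lower_degree[OF bil orth order_refl] by blast
  moreover have "f = Q n + g"
    by (simp add: g_def)
  ultimately show ?thesis
    by (simp add: form_add_right[OF bil])
qed

section \<open>The connection coefficients as coordinates\<close>

lemma L_matrix_above_diagonal: "n < m \<Longrightarrow> L_matrix h k B C n m = 0"
  by (auto simp: L_matrix_def)

text \<open>The identity \<open>Q n / k n = (\<Sum>j\<le>n. L n j (P j / h j))\<close> with the
  normalizations cleared: row \<open>n\<close> of \<open>L\<close> lists the coordinates of the normalized polynomial
  \<open>Q n / k n\<close> in the normalized basis \<open>P j / h j\<close>.\<close>

lemma connection_expansion: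
  fixes h k :: "nat \<Rightarrow> real"
  assumes conn: "connection_coeffs P Q B C"
    and h: "\<And>n. h n > 0" and k: "\<And>n. k n > 0"
  shows "Q n = (\<Sum>j\<le>n. smult (k n * L_matrix h k B C n j / h j) (P j))"
proof -
  have nz: "h j \<noteq> 0" "k j \<noteq> 0" for j
    using h[of j] k[of j] by auto
  consider "n = 0" | "n = 1" | m where "n = Suc (Suc m)"
    by (metis One_nat_def not0_implies_Suc)
  then show ?thesis
  proof cases
    case 1
    then show ?thesis
      using conn nz by (simp add: connection_coeffs_def L_matrix_def)
  next
    case 2
    then show ?thesis
      using conn nz by (simp add: connection_coeffs_def L_matrix_def)
  next
    case 3
    have "(\<Sum>j<m. smult (k n * L_matrix h k B C n j / h j) (P j)) = 0"
      by (rule sum.neutral) (auto simp: 3 L_matrix_def)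
    moreover have "{..n} = insert n (insert (Suc m) (insert m {..<m}))"
      using 3 by auto
    moreover have "Q n = P n + smult (B n) (P (Suc m)) + smult (C n) (P m)"
      using conn 3 by (simp add: connection_coeffs_def)
    ultimately show ?thesis
      using nz 3 by (simp add: L_matrix_def)
  qed
qed

text \<open>Pairing \<open>Q n\<close> with \<open>P m\<close> reads off its coordinate. For \<open>m > n\<close> both sides vanish, so the
  two indices may be arbitrary.\<close>

lemma connection_coordinate:
  fixes h k :: "nat \<Rightarrow> real"
  assumes bil: "symmetric_bilinear_form \<phi>" and orth: "monic_orthogonal_polys \<phi> P"
    and conn: "connection_coeffs P Q B C"
    and h: "\<And>n. h n > 0 \<and> (h n)\<^sup>2 = \<phi> (P n) (P n)" and k: "\<And>n. k n > 0"
  shows "\<phi> (Q n) (P m) = k n * L_matrix h k B C n m * h m"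
proof -
  let ?c = "\<lambda>j. k n * L_matrix h k B C n j / h j"
  have "\<phi> (Q n) (P m) = \<phi> (P m) (Q n)"
    by (rule form_sym[OF bil])
  also have "\<dots> = (\<Sum>j\<le>n. ?c j * \<phi> (P m) (P j))"
    by (subst connection_expansion[where h = h and k = k, OF conn])
      (simp_all add: h k form_sum_right[OF bil] form_smult_right[OF bil])
  also have "\<dots> = (\<Sum>j\<le>n. if j = m then ?c m * (h m)\<^sup>2 else 0)"
    using orth h by (intro sum.cong) (auto simp: monic_orthogonal_polys_def)
  also have "\<dots> = (if m \<le> n then ?c m * (h m)\<^sup>2 else 0)"
    by simp
  also have "\<dots> = k n * L_matrix h k B C n m * h m"
  proof (cases "m \<le> n")
    case True
    have "h m \<noteq> 0"
      using h[of m] by auto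
    with True show ?thesis
      by (simp add: power2_eq_square)
  next
    case False
    then show ?thesis
      by (simp add: L_matrix_above_diagonal)
  qed
  finally show ?thesis .
qed

section \<open>The Cholesky factor and the norm ratios\<close>

lemma J_matrix_entry:
  fixes h k :: "nat \<Rightarrow> real"
  assumes ger: "double_geronimus \<phi> \<psi>" and orth: "monic_orthogonal_polys \<phi> P"
    and conn: "connection_coeffs P Q B C"
    and h: "\<And>n. h n > 0 \<and> (h n)\<^sup>2 = \<phi> (P n) (P n)" and k: "\<And>n. k n > 0"
  shows "J_matrix \<psi> Q k n m = (\<Sum>j\<le>m. L_matrix h k B C n j * L_matrix h k B C m j)"
proof -
  let ?L = "L_matrix h k B C"
  note bil = double_geronimus_imp_symmetric_bilinear[OF ger]
  have nz: "h j \<noteq> 0" "k j \<noteq> 0" for j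
    using h[of j] k[of j] by auto
  \<comment> \<open>Expanding only the second argument leaves pairings that are coordinates of the first.\<close>
  have "\<phi> (Q n) (Q m) = (\<Sum>j\<le>m. (k m * ?L m j / h j) * \<phi> (Q n) (P j))"
    by (subst connection_expansion[where h = h and k = k and n = m, OF conn])
      (simp_all add: h k form_sum_right[OF bil] form_smult_right[OF bil])
  also have "\<dots> = (\<Sum>j\<le>m. k n * k m * (?L n j * ?L m j))"
    using connection_coordinate[where h = h and k = k, OF bil orth conn h k] nz
    by (intro sum.cong) simp_all
  also have "\<dots> = k n * k m * (\<Sum>j\<le>m. ?L n j * ?L m j)"
    by (simp add: sum_distrib_left)
  finally have gram: "\<phi> (Q n) (Q m) = k n * k m * (\<Sum>j\<le>m. ?L n j * ?L m j)" .
  have "J_matrix \<psi> Q k n m = \<phi> (smult (1 / k n) (Q n)) (smult (1 / k m) (Q m))"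
    using ger by (simp only: J_matrix_def double_geronimus_def)
  also have "\<dots> = \<phi> (Q n) (Q m) / (k n * k m)"
    by (simp add: form_smult_left[OF bil] form_smult_right[OF bil])
  finally show ?thesis
    using nz by (simp add: gram)
qed

lemma second_connection_coeff:
  fixes h :: "nat \<Rightarrow> real"
  assumes ger: "double_geronimus \<phi> \<psi>"
    and orthP: "monic_orthogonal_polys \<phi> P" and orthQ: "monic_orthogonal_polys \<psi> Q"
    and conn: "connection_coeffs P Q B C"
    and h: "\<And>n. h n > 0 \<and> (h n)\<^sup>2 = \<phi> (P n) (P n)"
  shows "C (n + 2) * (h n)\<^sup>2 = \<psi> (Q (n + 2)) (Q (n + 2))"
proof -
  note bil = double_geronimus_imp_symmetric_bilinear[OF ger]
  have P: "degree (P n) = n" "lead_coeff (P n) = 1"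
    using monic_orthogonal_coeff[OF orthP] monic_orthogonal_degree[OF orthP] by auto
  then have "P n \<noteq> 0"
    by auto
  then have lead: "degree (monom 1 2 * P n) = n + 2" "lead_coeff (monom 1 2 * P n) = 1"
    using P(1) by (simp add: degree_mult_eq degree_monom_eq)
      (simp only: lead_coeff_mult lead_coeff_monom P(2) mult_1)
  have "C (n + 2) * (h n)\<^sup>2 = \<phi> (Q (n + 2)) (P n)"
    \<comment> \<open>The factor \<open>k n\<close> in the coordinate cancels against the denominator in \<open>L\<close>,
       so any positive \<open>k\<close> gives the same value.\<close>
    using connection_coordinate[where h = h and k = "\<lambda>_. 1", OF bil orthP conn h]
    by (simp add: L_matrix_def power2_eq_square)
  also have "\<dots> = \<psi> (Q (n + 2)) (monom 1 2 * P n)"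
    using ger by (simp add: double_geronimus_def)
  also have "\<dots> = \<psi> (Q (n + 2)) (Q (n + 2))"
    using ger orthQ lead unfolding double_geronimus_def
    by (blast intro: monic_orthogonal_same_degree)
  finally show ?thesis .
qed

theorem theorem5p1:
  fixes \<mu> :: "real measure"
    and \<psi> :: poly_form
    and P Pss :: "nat \<Rightarrow> real poly"
    and h hss B C :: "nat \<Rightarrow> real"
  assumes "borel_measure_with_moments \<mu>"
    and "double_geronimus (measure_form \<mu>) \<psi>"
    and "positive_definite_form (measure_form \<mu>)"
    and "positive_definite_form \<psi>"
    and "monic_orthogonal_polys (measure_form \<mu>) P"
    and "monic_orthogonal_polys \<psi> Pss"
    and "\<And>n. h n > 0 \<and> (h n)\<^sup>2 = measure_form \<mu> (P n) (P n)"
    and "\<And>n. hss n > 0 \<and> (hss n)\<^sup>2 = \<psi> (Pss n) (Pss n)"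
    and "connection_coeffs P Pss B C"
  shows "cholesky_decomposition (J_matrix \<psi> Pss hss) (L_matrix h hss B C) \<and>
         (\<forall>n. h (n + 2) / hss (n + 2) = h (n + 2) / (sqrt (C (n + 2)) * h n))"
proof (intro conjI allI)
  let ?L = "L_matrix h hss B C"
  have pos: "h n > 0" "hss n > 0" for n
    using assms(7,8) by blast+
  have "J_matrix \<psi> Pss hss n m = (\<Sum>j. ?L n j * ?L m j)" for n m
  proof -
    have "(\<Sum>j. ?L n j * ?L m j) = (\<Sum>j\<le>m. ?L n j * ?L m j)"
      by (rule suminf_finite) (simp_all add: L_matrix_above_diagonal)
    then show ?thesis
      using J_matrix_entry[where h = h and k = hss, OF assms(2,5,9,7) pos(2)] by simp
  qed
  then have "J_matrix \<psi> Pss hss = inf_matrix_mult ?L (inf_transpose ?L)"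
    by (intro ext) (simp add: inf_matrix_mult_def inf_transpose_def)
  moreover have "?L i j = 0" if "i < j" for i j
    using that by (rule L_matrix_above_diagonal)
  moreover have "?L i i > 0" for i
    using pos by (simp add: L_matrix_def)
  ultimately show "cholesky_decomposition (J_matrix \<psi> Pss hss) ?L"
    by (simp add: cholesky_decomposition_def)
next
  fix n
  have "(hss (n + 2))\<^sup>2 = C (n + 2) * (h n)\<^sup>2"
    using assms(8)[of "n + 2"] second_connection_coeff[where h = h, OF assms(2,5,6,9,7)]
    by (metis (no_types))
  then have "sqrt ((hss (n + 2))\<^sup>2) = sqrt (C (n + 2)) * sqrt ((h n)\<^sup>2)"
    by (simp only: real_sqrt_mult)
  moreover have "h n > 0" "hss (n + 2) > 0"
    using assms(7,8) by blast+
  ultimately have "hss (n + 2) = sqrt (C (n + 2)) * h n"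
    by simp
  then show "h (n + 2) / hss (n + 2) = h (n + 2) / (sqrt (C (n + 2)) * h n)"
    by simp
qed

end
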